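(* Let $R$ be a commutative ring with $1\neq 0$, let $S$ be a multiplicatively closed subset of $R$, and let $I$ and $J$ be ideals of $R$. The following statements hold. (1) $V_S(I)\subseteq V_S(J)$ if and only if $\sqrt[S]{J}\subseteq \sqrt[S]{I}$. (2) $V_S(I)=V_S(J)$ if and only if $\sqrt[S]{I}=\sqrt[S]{J}$. (3) $V_S(I)=\mathrm{Spec}_SR$ if and only if $\sqrt[S]{I}=\sqrt[S]{(0)}$. (4) $V_S(I)=\emptyset$ if and only if $\sqrt[S]{I}=R$, if and only if $I\cap S\neq\emptyset$.
   Context: A multiplicatively closed subset $S$ of $R$ satisfies $0\notin S$, $1\in S$, and $ss'\in S$ for all $s,s'\in S$. An ideal $P$ of $R$ is $S$-prime if $P\cap S=\emptyset$ and there exists $s\in S$ such that for all $a,b\in R$, $ab\in P$ implies $sa\in P$ or $sb\in P$. $\mathrm{Spec}_SR$ is the set of all $S$-prime ideals of $R$. For $E\subseteq R$, $V_S(E)=\{P\in\mathrm{Spec}_SR : sE\subseteq P \text{ for some } s\in S\}$. The $S$-radical of an ideal $I$ is $\sqrt[S]{I}=\{a\in R : sa^n\in I\text{ for some } s\in S \text{ and } n\in\mathbb{N}\}$ ($\mathbb{N}$ the positive integers). *)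

theory Defs
  imports "HOL-Algebra.Ideal"
begin

definition mult_closed :: "('a, 'b) ring_scheme \<Rightarrow> 'a set \<Rightarrow> bool" where
  "mult_closed R S \<longleftrightarrow> S \<subseteq> carrier R \<and> \<zero>\<^bsub>R\<^esub> \<notin> S \<and> \<one>\<^bsub>R\<^esub> \<in> S
     \<and> (\<forall>s\<in>S. \<forall>s'\<in>S. s \<otimes>\<^bsub>R\<^esub> s' \<in> S)"

text \<open>The element \<open>s\<close> is chosen before \<open>a\<close> and \<open>b\<close>: it depends on the ideal only.\<close>

definition S_prime :: "('a, 'b) ring_scheme \<Rightarrow> 'a set \<Rightarrow> 'a set \<Rightarrow> bool" where
  "S_prime R S P \<longleftrightarrow> ideal P R \<and> P \<inter> S = {} \<and>
     (\<exists>s\<in>S. \<forall>a\<in>carrier R. \<forall>b\<in>carrier R.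
        a \<otimes>\<^bsub>R\<^esub> b \<in> P \<longrightarrow> s \<otimes>\<^bsub>R\<^esub> a \<in> P \<or> s \<otimes>\<^bsub>R\<^esub> b \<in> P)"

definition S_Spec :: "('a, 'b) ring_scheme \<Rightarrow> 'a set \<Rightarrow> 'a set set" where
  "S_Spec R S = {P. S_prime R S P}"

text \<open>\<open>V_S(E)\<close>, intended for arbitrary subsets \<open>E\<close> of the carrier; the set \<open>sE\<close> of all
  products \<open>se\<close> with \<open>e\<close> in \<open>E\<close> is written with the library's multiplicative left translate.\<close>

definition S_V :: "('a, 'b) ring_scheme \<Rightarrow> 'a set \<Rightarrow> 'a set \<Rightarrow> 'a set set" where
  "S_V R S E = {P \<in> S_Spec R S. \<exists>s\<in>S. s <#\<^bsub>R\<^esub> E \<subseteq> P}"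

definition S_radical :: "('a, 'b) ring_scheme \<Rightarrow> 'a set \<Rightarrow> 'a set \<Rightarrow> 'a set" where
  "S_radical R S I =
     {a \<in> carrier R. \<exists>s\<in>S. \<exists>n::nat. n > 0 \<and> s \<otimes>\<^bsub>R\<^esub> (a [^]\<^bsub>R\<^esub> n) \<in> I}"

end

theory Submission
  imports Defs "HOL-Algebra.Ring_Divisibility"
begin

text \<open>
  Two facts carry the proof.

  Prime ideals disjoint from \<open>S\<close> are \<open>S\<close>-prime, with \<open>s = \<one>\<close>, and there are enough of them: the
  \<open>S\<close>-radical of \<open>I\<close> is the intersection of all prime ideals that contain \<open>I\<close> and miss \<open>S\<close>
  (lemma \<open>S_radical_eq_Inter_primeideals\<close>). In the localization at \<open>S\<close> this says that the
  radical of the extension of \<open>I\<close> is the intersection of the primes above it; here it is obtained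
  inside \<open>R\<close> from Krull's separation lemma. A prime ideal that misses \<open>S\<close> lies in \<open>V\<^sub>S(I)\<close> exactly when it contains \<open>I\<close>, so
  an inclusion \<open>V\<^sub>S(I) \<subseteq> V\<^sub>S(J)\<close> reverses to one of radicals.

  Conversely, an \<open>S\<close>-prime ideal \<open>P\<close> with witness \<open>s\<close> is \<open>S\<close>-radical up to that single \<open>s\<close>: if
  \<open>u a\<^sup>n \<in> P\<close> for some \<open>u \<in> S\<close> and \<open>n\<close>, then \<open>s a \<in> P\<close> (lemma \<open>S_prime_uniform_radical\<close>).
  Membership in \<open>V\<^sub>S(J)\<close> asks for one multiplier that works for all of \<open>J\<close>, and \<open>s\<close> provides it,
  because it depends on neither \<open>a\<close> nor \<open>u\<close> nor \<open>n\<close>. Hence \<open>V\<^sub>S(I)\<close> depends only on the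
  \<open>S\<close>-radical of \<open>I\<close>, in an inclusion-reversing way.

  The statements about full and empty \<open>V\<^sub>S(I)\<close> are the instances \<open>J = (0)\<close>, where \<open>V\<^sub>S(J)\<close> is
  everything, and \<open>J = R\<close>, where \<open>V\<^sub>S(J)\<close> is empty. The radical is all of \<open>R\<close> exactly when it
  contains \<open>\<one>\<close>, which means that some \<open>s \<in> S\<close> lies in \<open>I\<close>.
\<close>

section \<open>Separating an ideal from a multiplicative set\<close>

text \<open>
  Krull's separation lemma. By Zorn's lemma there is an ideal \<open>M\<close> maximal among those containing \<open>I\<close>
  and missing \<open>T\<close>. If \<open>a, b \<notin> M\<close>, then \<open>M + (a)\<close> and \<open>M + (b)\<close> both meet \<open>T\<close>; the product of a
  point from each lies in \<open>T\<close> and in \<open>M + (ab)\<close>, so \<open>ab \<notin> M\<close>.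
\<close>

lemma (in cring) primeideal_avoiding_submonoid:
  assumes "ideal I R" and "submonoid T R" and disj: "I \<inter> T = {}"
  obtains P where "primeideal P R" and "I \<subseteq> P" and "P \<inter> T = {}"
proof -
  interpret T: submonoid T R by fact
  define A where "A = {K. ideal K R \<and> I \<subseteq> K \<and> K \<inter> T = {}}"
  have "\<exists>M\<in>A. \<forall>X\<in>A. M \<subseteq> X \<longrightarrow> X = M"
  proof (rule subset_Zorn_nonempty)
    show "A \<noteq> {}"
      using assms by (auto simp: A_def)
  next
    fix C assume "C \<noteq> {}" and C: "subset.chain A C"
    then have "subset.chain {K. ideal K R} C"
      by (auto simp: A_def subset.chain_def)
    then have "ideal (\<Union>C) R"
      using chain_Union_is_ideal \<open>C \<noteq> {}\<close> by presburger
    moreover have "C \<subseteq> A"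
      using C by (simp add: subset.chain_def)
    ultimately show "\<Union>C \<in> A"
      using \<open>C \<noteq> {}\<close> by (fastforce simp: A_def)
  qed
  then obtain M where "M \<in> A" and max: "\<And>K. K \<in> A \<Longrightarrow> M \<subseteq> K \<Longrightarrow> K = M"
    by blast
  then have "ideal M R" "I \<subseteq> M" and MT: "M \<inter> T = {}"
    by (auto simp: A_def)
  interpret M: ideal M R by fact
  have meets_T: "\<exists>m\<in>M. \<exists>r\<in>carrier R. m \<oplus> r \<otimes> a \<in> T" if a: "a \<in> carrier R" "a \<notin> M" for a
  proof -
    let ?K = "M <+>\<^bsub>R\<^esub> PIdl a"
    have "ideal ?K R"
      using add_ideals \<open>ideal M R\<close> cgenideal_ideal a by blast
    moreover have "M \<subseteq> ?K"
    proof
      fix m assume "m \<in> M"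
      moreover have "\<zero> \<in> PIdl a"
        using cgenideal_ideal[OF a(1)] by (simp add: additive_subgroup.zero_closed ideal.axioms(1))
      moreover have "m = m \<oplus> \<zero>"
        using M.Icarr[OF \<open>m \<in> M\<close>] by simp
      ultimately show "m \<in> ?K"
        unfolding set_add_def' by blast
    qed
    moreover have "a = \<zero> \<oplus> a"
      using a(1) by simp
    then have "a \<in> ?K"
      unfolding set_add_def' using M.zero_closed cgenideal_self[OF a(1)] by blast
    ultimately have "?K \<inter> T \<noteq> {}"
      using max[of ?K] \<open>I \<subseteq> M\<close> a(2) by (auto simp: A_def)
    then show ?thesis
      by (auto simp: set_add_def' cgenideal_def)
  qed
  have "primeideal M R"
  proof (rule primeidealI[OF \<open>ideal M R\<close> is_cring])
    show "carrier R \<noteq> M"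
      using MT T.one_closed by auto
  next
    fix a b assume ab: "a \<in> carrier R" "b \<in> carrier R" "a \<otimes> b \<in> M"
    show "a \<in> M \<or> b \<in> M"
    proof (rule ccontr)
      assume "\<not> (a \<in> M \<or> b \<in> M)"
      then obtain m r n q where
        mr: "m \<in> M" "r \<in> carrier R" "m \<oplus> r \<otimes> a \<in> T" and
        nq: "n \<in> M" "q \<in> carrier R" "n \<oplus> q \<otimes> b \<in> T"
        using meets_T ab by meson
      have [simp]: "m \<in> carrier R" "n \<in> carrier R"
        using mr nq M.Icarr by auto
      have "(m \<oplus> r \<otimes> a) \<otimes> (n \<oplus> q \<otimes> b)
          = m \<otimes> (n \<oplus> q \<otimes> b) \<oplus> ((r \<otimes> a) \<otimes> n \<oplus> (r \<otimes> q) \<otimes> (a \<otimes> b))"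
        using ab mr(2) nq(2) by (simp add: l_distr r_distr m_ac a_ac)
      also have "\<dots> \<in> M"
        by (intro M.a_closed M.I_r_closed[OF mr(1)] M.I_l_closed[OF nq(1)] M.I_l_closed[OF ab(3)])
          (use ab mr(2) nq(2) in auto)
      finally have "(m \<oplus> r \<otimes> a) \<otimes> (n \<oplus> q \<otimes> b) \<in> M" .
      then show False
        using T.m_closed[OF mr(3) nq(3)] MT by auto
    qed
  qed
  then show thesis
    using that \<open>I \<subseteq> M\<close> MT by blast
qed

lemma (in primeideal) pow_memD:
  assumes "a \<in> carrier R" and "a [^] (n::nat) \<in> I"
  shows "a \<in> I"
  using assms(2)
proof (induction n)
  case 0
  then show ?case
    using one_imp_carrier I_notcarr by auto
next
  case (Suc n)
  then show ?case
    using I_prime[of "a [^] n" a] assms(1) by auto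
qed

section \<open>The radical relative to a multiplicative set\<close>

text \<open>
  If \<open>a\<close> is not in the radical, the set of all \<open>s a\<^sup>n\<close> with \<open>s \<in> S\<close> is a submonoid that misses \<open>I\<close>
  and contains both \<open>S\<close> and \<open>a\<close>; a prime separating it from \<open>I\<close> therefore misses \<open>S\<close> and
  omits \<open>a\<close>. The intersection with the carrier covers the case that \<open>I\<close> meets \<open>S\<close>, where there is
  no such prime and the radical is the whole ring.
\<close>

lemma (in cring) S_radical_eq_Inter_primeideals:
  assumes S: "mult_closed R S" and I: "ideal I R"
  shows "S_radical R S I = carrier R \<inter> \<Inter>{P. primeideal P R \<and> P \<inter> S = {} \<and> I \<subseteq> P}"
    (is "_ = carrier R \<inter> \<Inter>?Ps")
proof (intro equalityI subsetI)
  fix a assume "a \<in> S_radical R S I"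
  then obtain s n where a: "a \<in> carrier R" and s: "s \<in> S" and san: "s \<otimes> a [^] (n::nat) \<in> I"
    by (auto simp: S_radical_def)
  have "a \<in> P" if P: "P \<in> ?Ps" for P
  proof -
    interpret primeideal P R using P by simp
    have "s \<in> P \<or> a [^] n \<in> P"
      using I_prime[of s "a [^] n"] P s san a S by (auto simp: mult_closed_def)
    then show ?thesis
      using P s a pow_memD by blast
  qed
  with a show "a \<in> carrier R \<inter> \<Inter>?Ps"
    by blast
next
  fix a assume aPs: "a \<in> carrier R \<inter> \<Inter>?Ps"
  then have a: "a \<in> carrier R" by blast
  show "a \<in> S_radical R S I"
  proof (rule ccontr)
    assume notin: "a \<notin> S_radical R S I"
    interpret I: ideal I R by fact
    let ?T = "{s \<otimes> a [^] n | s n. s \<in> S \<and> n \<in> (UNIV::nat set)}"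
    have Sc: "s \<in> carrier R" if "s \<in> S" for s
      using S that by (auto simp: mult_closed_def)
    have T: "submonoid ?T R"
    proof
      show "?T \<subseteq> carrier R"
        using Sc a by auto
    next
      fix x y assume "x \<in> ?T" "y \<in> ?T"
      then obtain s m t n where st: "s \<in> S" "t \<in> S"
        and xy: "x = s \<otimes> a [^] (m::nat)" "y = t \<otimes> a [^] (n::nat)"
        by auto
      have "x \<otimes> y = (s \<otimes> t) \<otimes> a [^] (m + n)"
        using Sc[OF st(1)] Sc[OF st(2)] a by (simp add: xy nat_pow_mult[symmetric] m_ac)
      moreover have "s \<otimes> t \<in> S"
        using S st by (auto simp: mult_closed_def)
      ultimately show "x \<otimes> y \<in> ?T"
        by blast
    next
      have "\<one> = \<one> \<otimes> a [^] (0::nat)" by simp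
      then show "\<one> \<in> ?T"
        using S unfolding mult_closed_def by blast
    qed
    have "I \<inter> ?T = {}"
    proof (rule equals0I)
      fix x assume "x \<in> I \<inter> ?T"
      then obtain s n where s: "s \<in> S" and x: "s \<otimes> a [^] (n::nat) \<in> I"
        by auto
      \<comment> \<open>The radical demands a positive exponent, so one more factor \<open>a\<close> is multiplied in.\<close>
      have "s \<otimes> a [^] Suc n \<in> I"
        using I.I_r_closed[OF x a] Sc[OF s] a by (simp add: m_assoc)
      then show False
        using notin a s zero_less_Suc unfolding S_radical_def by blast
    qed
    then obtain P where P: "primeideal P R" "I \<subseteq> P" "P \<inter> ?T = {}"
      using primeideal_avoiding_submonoid[OF I T] by blast
    have "S \<subseteq> ?T"
    proof
      fix s assume "s \<in> S"
      moreover have "s = s \<otimes> a [^] (0::nat)"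
        using Sc[OF \<open>s \<in> S\<close>] by simp
      ultimately show "s \<in> ?T" by blast
    qed
    then have "P \<in> ?Ps"
      using P by blast
    then have "a \<in> P"
      using aPs by blast
    moreover have "a = \<one> \<otimes> a [^] (1::nat)"
      using a by simp
    then have "a \<in> ?T"
      using S unfolding mult_closed_def by blast
    ultimately show False
      using P(3) by blast
  qed
qed

lemma (in cring) subset_S_radical:
  assumes "mult_closed R S" and "ideal I R"
  shows "I \<subseteq> S_radical R S I"
  unfolding S_radical_eq_Inter_primeideals[OF assms]
  by (intro Int_greatest Inter_greatest subsetI) (auto intro: ideal.Icarr[OF assms(2)])

lemma (in cring) S_radical_carrier:
  assumes "mult_closed R S"
  shows "S_radical R S (carrier R) = carrier R"
proof
  show "S_radical R S (carrier R) \<subseteq> carrier R"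
    unfolding S_radical_def by blast
qed (rule subset_S_radical[OF assms oneideal])

lemma (in cring) S_radical_eq_carrier_iff:
  assumes S: "mult_closed R S" and I: "ideal I R"
  shows "S_radical R S I = carrier R \<longleftrightarrow> I \<inter> S \<noteq> {}"
proof
  assume "S_radical R S I = carrier R"
  then have "\<one> \<in> S_radical R S I"
    by simp
  then obtain s where "s \<in> S" "s \<otimes> \<one> \<in> I"
    by (auto simp: S_radical_def)
  then show "I \<inter> S \<noteq> {}"
    using S by (auto simp: mult_closed_def)
next
  assume "I \<inter> S \<noteq> {}"
  then have "{P. primeideal P R \<and> P \<inter> S = {} \<and> I \<subseteq> P} = {}"
    by blast
  then show "S_radical R S I = carrier R"
    by (simp only: S_radical_eq_Inter_primeideals[OF assms] Inter_empty Int_UNIV_right)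
qed

section \<open>Prime ideals relative to a multiplicative set\<close>

text \<open>
  The ideal \<open>{a. s a \<in> P}\<close> attached to a witness \<open>s\<close> is an ordinary prime ideal that misses \<open>S\<close>,
  which is why a single \<open>s\<close> absorbs all powers. In elements: a factor \<open>u \<in> S\<close> can be traded for
  \<open>s\<close>, because \<open>u a \<in> P\<close> gives \<open>s u \<in> P\<close> or \<open>s a \<in> P\<close>, and \<open>s u\<close> lies in \<open>S\<close>. Applying the witness
  to \<open>a\<^sup>n \<cdot> (s a) \<in> P\<close> gives \<open>s a\<^sup>n \<in> P\<close>, a lower power, or \<open>s\<^sup>2 a \<in> P\<close>, where \<open>s\<^sup>2\<close> can be traded.
\<close>

lemma (in cring) S_prime_uniform_radical:
  assumes S: "mult_closed R S" and P: "S_prime R S P"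
  obtains s where "s \<in> S"
    and "\<And>u a n. u \<in> S \<Longrightarrow> a \<in> carrier R \<Longrightarrow> u \<otimes> a [^] (n::nat) \<in> P \<Longrightarrow> s \<otimes> a \<in> P"
proof -
  from P obtain s where s: "s \<in> S" and disj: "P \<inter> S = {}"
    and prime: "\<And>a b. a \<in> carrier R \<Longrightarrow> b \<in> carrier R \<Longrightarrow> a \<otimes> b \<in> P \<Longrightarrow> s \<otimes> a \<in> P \<or> s \<otimes> b \<in> P"
    by (auto simp: S_prime_def)
  have Sc: "x \<in> carrier R" if "x \<in> S" for x
    using S that by (auto simp: mult_closed_def)
  have Sm: "x \<otimes> y \<in> S" if "x \<in> S" "y \<in> S" for x y
    using S that by (auto simp: mult_closed_def)
  have cancel: "s \<otimes> a \<in> P" if "u \<in> S" "a \<in> carrier R" "u \<otimes> a \<in> P" for u a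
    using prime[of u a] Sm[of s u] Sc that s disj by blast
  have pow: "s \<otimes> a \<in> P" if a: "a \<in> carrier R" and "s \<otimes> a [^] (n::nat) \<in> P" for a n
    using that(2)
  proof (induction n)
    case 0
    then show ?case
      using Sc s disj by auto
  next
    case (Suc n)
    then have "a [^] n \<otimes> (s \<otimes> a) \<in> P"
      using Sc[OF s] a by (simp add: m_ac)
    then have "s \<otimes> a [^] n \<in> P \<or> (s \<otimes> s) \<otimes> a \<in> P"
      using prime[of "a [^] n" "s \<otimes> a"] Sc[OF s] a by (simp add: m_assoc)
    then show ?case
      using Suc.IH cancel[of "s \<otimes> s" a] Sm s a by blast
  qed
  show thesis
  proof (rule that[OF s])
    fix u a and n :: nat
    assume "u \<in> S" "a \<in> carrier R" "u \<otimes> a [^] n \<in> P"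
    then show "s \<otimes> a \<in> P"
      using pow[of a n] cancel[of u "a [^] n"] nat_pow_closed by blast
  qed
qed

lemma (in cring) primeideal_imp_S_prime:
  assumes S: "mult_closed R S" and "primeideal P R" and "P \<inter> S = {}"
  shows "S_prime R S P"
proof -
  interpret primeideal P R by fact
  have "\<one> \<in> S"
    using S by (simp add: mult_closed_def)
  then show ?thesis
    unfolding S_prime_def using is_ideal assms(3) by (auto intro!: bexI[of _ \<one>] dest: I_prime)
qed

lemma (in cring) primeideal_in_S_V_iff:
  assumes S: "mult_closed R S" and "primeideal P R" and disj: "P \<inter> S = {}"
    and E: "E \<subseteq> carrier R"
  shows "P \<in> S_V R S E \<longleftrightarrow> E \<subseteq> P"
proof
  interpret primeideal P R by fact
  {
    assume "P \<in> S_V R S E"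
    then obtain s where s: "s \<in> S" and sE: "s <# E \<subseteq> P"
      by (auto simp: S_V_def)
    show "E \<subseteq> P"
    proof
      fix e assume "e \<in> E"
      then have "s \<otimes> e \<in> P"
        using sE by (auto simp: l_coset_def)
      then show "e \<in> P"
        using I_prime[of s e] s S E \<open>e \<in> E\<close> disj by (auto simp: mult_closed_def)
    qed
  next
    assume "E \<subseteq> P"
    then have "\<one> <# E \<subseteq> P"
      using E by (auto simp: l_coset_def)
    then show "P \<in> S_V R S E"
      using primeideal_imp_S_prime[OF assms(1-3)] S
      by (auto simp: S_V_def S_Spec_def mult_closed_def)
  }
qed

section \<open>Closed sets and radicals\<close>

lemma (in cring) S_V_subset_iff:
  assumes S: "mult_closed R S" and I: "ideal I R" and J: "ideal J R"
  shows "S_V R S I \<subseteq> S_V R S J \<longleftrightarrow> S_radical R S J \<subseteq> S_radical R S I"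
proof
  assume V: "S_V R S I \<subseteq> S_V R S J"
  have "J \<subseteq> P" if "primeideal P R" "P \<inter> S = {}" "I \<subseteq> P" for P
    using V that I J primeideal_in_S_V_iff[OF S that(1,2)]
    by (meson additive_subgroup.a_subset ideal.axioms(1) subsetD)
  then show "S_radical R S J \<subseteq> S_radical R S I"
    unfolding S_radical_eq_Inter_primeideals[OF S I] S_radical_eq_Inter_primeideals[OF S J]
    by blast
next
  assume rad: "S_radical R S J \<subseteq> S_radical R S I"
  show "S_V R S I \<subseteq> S_V R S J"
  proof
    fix P assume "P \<in> S_V R S I"
    then obtain t where P: "S_prime R S P" and t: "t \<in> S" and tI: "t <# I \<subseteq> P"
      by (auto simp: S_V_def S_Spec_def)
    from S_prime_uniform_radical[OF S P] obtain s where s: "s \<in> S"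
      and absorb: "\<And>u a n. u \<in> S \<Longrightarrow> a \<in> carrier R \<Longrightarrow> u \<otimes> a [^] (n::nat) \<in> P \<Longrightarrow> s \<otimes> a \<in> P"
      by blast
    have "s \<otimes> a \<in> P" if "a \<in> J" for a
    proof -
      have "a \<in> S_radical R S I"
        using that subset_S_radical[OF S J] rad by blast
      then obtain u n where a: "a \<in> carrier R" and u: "u \<in> S" and "u \<otimes> a [^] (n::nat) \<in> I"
        by (auto simp: S_radical_def)
      then have "t \<otimes> (u \<otimes> a [^] n) \<in> P"
        using tI by (auto simp: l_coset_def)
      moreover have "t \<in> carrier R" "u \<in> carrier R" "t \<otimes> u \<in> S"
        using S t u by (auto simp: mult_closed_def)
      ultimately show ?thesis
        using absorb[of "t \<otimes> u" a n] a by (simp add: m_assoc)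
    qed
    then show "P \<in> S_V R S J"
      using P s by (auto simp: S_V_def S_Spec_def l_coset_def)
  qed
qed

lemma (in cring) S_V_eq_iff:
  assumes "mult_closed R S" and "ideal I R" and "ideal J R"
  shows "S_V R S I = S_V R S J \<longleftrightarrow> S_radical R S I = S_radical R S J"
  unfolding set_eq_subset S_V_subset_iff[OF assms] S_V_subset_iff[OF assms(1,3,2)] by blast

lemma (in cring) S_V_zero:
  assumes "mult_closed R S"
  shows "S_V R S {\<zero>} = S_Spec R S"
proof -
  have "\<one> \<in> S"
    using assms by (simp add: mult_closed_def)
  moreover have "\<one> <# {\<zero>} \<subseteq> P" if "S_prime R S P" for P
    using that
    by (auto simp: S_prime_def l_coset_def additive_subgroup.zero_closed ideal.axioms(1))
  ultimately show ?thesis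
    by (auto simp: S_V_def S_Spec_def)
qed

lemma (in cring) S_V_carrier:
  assumes "mult_closed R S"
  shows "S_V R S (carrier R) = {}"
proof -
  have False if "S_prime R S P" and s: "s \<in> S" and sub: "s <# carrier R \<subseteq> P" for P s
  proof -
    have "s \<otimes> \<one> \<in> P"
      using sub by (auto simp: l_coset_def)
    then show False
      using that assms by (auto simp: S_prime_def mult_closed_def)
  qed
  then show ?thesis
    by (auto simp: S_V_def S_Spec_def)
qed

theorem proposition2p4:
  fixes R :: "('a, 'b) ring_scheme" (structure)
    and S I J :: "'a set"
  assumes "cring R" and "\<one> \<noteq> \<zero>"
    and "mult_closed R S"
    and "ideal I R" and "ideal J R"
  shows "(S_V R S I \<subseteq> S_V R S J \<longleftrightarrow> S_radical R S J \<subseteq> S_radical R S I)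
    \<and> (S_V R S I = S_V R S J \<longleftrightarrow> S_radical R S I = S_radical R S J)
    \<and> (S_V R S I = S_Spec R S \<longleftrightarrow> S_radical R S I = S_radical R S {\<zero>})
    \<and> ((S_V R S I = {} \<longleftrightarrow> S_radical R S I = carrier R)
       \<and> (S_radical R S I = carrier R \<longleftrightarrow> I \<inter> S \<noteq> {}))"
proof -
  interpret cring R by fact
  note S = \<open>mult_closed R S\<close> and I = \<open>ideal I R\<close> and J = \<open>ideal J R\<close>
  show ?thesis
    using S_V_subset_iff[OF S I J] S_V_eq_iff[OF S I J]
      S_V_eq_iff[OF S I zeroideal] S_V_zero[OF S]
      S_V_eq_iff[OF S I oneideal] S_V_carrier[OF S] S_radical_carrier[OF S]
      S_radical_eq_carrier_iff[OF S I]
    by simp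
qed

end
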